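(* Let $y=(y_1,y_2,y_3)\in\mathbb{C}^3$. There exists an analytic map $\varphi:\mathbb{D}\to\mathbb{E}$ such that $\varphi(0)=(0,0,0)$ and $\varphi'(0)=y$ if and only if $$\max\{|y_1|,|y_2|\}+|y_3|\leq 1.$$
   Context: $\mathbb{D}=\{z\in\mathbb{C}:|z|<1\}$ is the open unit disc. The tetrablock is the domain $$\mathbb{E}=\{(x_1,x_2,x_3)\in\mathbb{C}^3: 1-x_1z-x_2w+x_3zw\neq 0 \text{ for all } z,w\in\mathbb{C} \text{ with } |z|\leq 1,\ |w|\leq 1\}.$$ "Analytic" means holomorphic. *)

theory Defs
  imports "HOL-Complex_Analysis.Complex_Analysis"
begin

definition tetrablock :: "(complex ^ 3) set" where
  "tetrablock =
     {x. \<forall>z w. norm z \<le> 1 \<longrightarrow> norm w \<le> 1 \<longrightarrow>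
           1 - x $ 1 * z - x $ 2 * w + x $ 3 * z * w \<noteq> 0}"

text \<open>
  The library predicate \<open>holomorphic_on\<close> and the operator \<open>deriv\<close> only cover functions with
  values in a normed field, so for maps into complex n-space both are taken componentwise.
\<close>

definition vec_holomorphic_on :: "(complex \<Rightarrow> complex ^ 'n) \<Rightarrow> complex set \<Rightarrow> bool"
    (infixl "vec'_holomorphic'_on" 50) where
  "\<phi> vec_holomorphic_on S \<longleftrightarrow> (\<forall>i. (\<lambda>z. \<phi> z $ i) holomorphic_on S)"

definition vec_deriv :: "(complex \<Rightarrow> complex ^ 'n) \<Rightarrow> complex \<Rightarrow> complex ^ 'n" where
  "vec_deriv \<phi> a = (\<chi> i. deriv (\<lambda>z. \<phi> z $ i) a)"

end

theory Submission
  imports Defs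
begin

text \<open>
  Solving \<open>1 - x\<^sub>1 z - x\<^sub>2 w + x\<^sub>3 z w = 0\<close> for \<open>z\<close> shows that \<open>x\<close> lies in the tetrablock exactly when
  the Moebius quotient \<open>(x\<^sub>1 - x\<^sub>3 w) / (1 - x\<^sub>2 w)\<close> has modulus below 1 for every \<open>w\<close> in the closed
  disc.

  Necessity. Along an analytic disc through the origin, this quotient is, for each fixed \<open>w\<close>, a
  self-map of the unit disc that fixes 0, with derivative \<open>y\<^sub>1 - y\<^sub>3 w\<close> there. The Schwarz lemma
  bounds that derivative by 1, and the unimodular \<open>w\<close> that aligns the two terms turns the bound
  into \<open>\<bar>y\<^sub>1\<bar> + \<bar>y\<^sub>3\<bar> \<le> 1\<close>. The tetrablock is symmetric in its first two coordinates, which gives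
  the bound for \<open>y\<^sub>2\<close>.

  Sufficiency. By the same symmetry let \<open>\<bar>y\<^sub>2\<bar> \<le> \<bar>y\<^sub>1\<bar> = a\<close>, and write \<open>y\<^sub>1 = a k\<close>, \<open>y\<^sub>2 = a m\<close>,
  \<open>y\<^sub>3 = k c\<close> with \<open>\<bar>k\<bar> = 1\<close> and \<open>\<bar>m\<bar> \<le> 1\<close>. The required disc is the rational map
    \<open>\<zeta> \<mapsto> (a k \<zeta>, a m \<zeta>, k \<zeta> (m \<zeta> + c)) / (1 + cnj c m \<zeta>)\<close>.
  It comes from the fact that the triples \<open>(A\<^sub>1\<^sub>1, A\<^sub>2\<^sub>2, det A)\<close> of strict 2-by-2 contractions \<open>A\<close>
  lie in the tetrablock. If \<open>a + \<bar>c\<bar> = 1\<close>, a matrix function \<open>B diag(\<zeta>, 1)\<close> with first-order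
  data \<open>y\<close> and \<open>B\<close> contractive has \<open>B(0)\<close> of norm 1, so \<open>B\<close> splits into a constant and a scalar
  Schur function; taking a Moebius map for the latter gives the formula. That its values lie in
  the tetrablock whenever \<open>a + \<bar>c\<bar> \<le> 1\<close> is checked directly: the defining equation, now solved for
  \<open>w\<close>, leads to the inequality \<open>quotient_gap_pos\<close> between two moduli, and the difference of their
  squares (\<open>quotient_gap_identity\<close>) can be arranged as a sum of three nonnegative terms that do
  not vanish together.
\<close>

section \<open>Necessity\<close>

lemma vector_in_tetrablock_iff:
  "vector [x1, x2, x3] \<in> tetrablock \<longleftrightarrow>
     (\<forall>z w. norm z \<le> 1 \<longrightarrow> norm w \<le> 1 \<longrightarrow> 1 - x1 * z - x2 * w + x3 * z * w \<noteq> 0)"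
  by (simp add: tetrablock_def)

lemma tetrablock_cross_less:
  fixes x :: "complex ^ 3"
  assumes "x \<in> tetrablock" "norm w \<le> 1"
  shows "norm (x $ 1 - x $ 3 * w) < norm (1 - x $ 2 * w)"
proof (rule ccontr)
  \<comment> \<open>Otherwise the solution \<open>z\<close> of the defining equation lies in the closed disc.\<close>
  let ?N = "x $ 1 - x $ 3 * w" and ?D = "1 - x $ 2 * w"
  assume "\<not> norm ?N < norm ?D"
  hence le: "norm ?D \<le> norm ?N" by simp
  have "norm (?D / ?N) \<le> 1"
    using le by (simp add: norm_divide divide_le_eq_1)
  moreover have "?D = ?N * (?D / ?N)"
    using le by (cases "?N = 0") auto
  moreover have "1 - x $ 1 * q - x $ 2 * w + x $ 3 * q * w = ?D - ?N * q" for q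
    by (simp add: algebra_simps)
  ultimately show False
    using assms unfolding tetrablock_def mem_Collect_eq by (metis eq_iff_diff_eq_0)
qed

lemma tetrablock_swap:
  "vector [x1, x2, x3] \<in> tetrablock \<longleftrightarrow> vector [x2, x1, x3] \<in> tetrablock"
proof -
  have "1 - x1 * z - x2 * w + x3 * z * w = 1 - x2 * w - x1 * z + x3 * w * z" for z w
    by simp
  thus ?thesis unfolding vector_in_tetrablock_iff by metis
qed

lemma obtain_aligning_phase:
  fixes u v :: complex
  obtains w where "norm w = 1" "norm (u - v * w) = norm u + norm v"
proof (cases "u = 0 \<or> v = 0")
  case True
  show ?thesis by (rule that[of 1]) (use True in auto)
next
  case False
  let ?w = "- (sgn u / sgn v)"
  have v: "v / sgn v = of_real (norm v)"
    using False by (simp add: sgn_eq)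
  have "u - v * ?w = sgn u * of_real (norm u) + sgn u * (v / sgn v)"
    using False by (simp add: sgn_eq)
  also have "\<dots> = sgn u * of_real (norm u + norm v)"
    unfolding v by (simp add: algebra_simps)
  finally have "norm (u - v * ?w) = norm u + norm v"
    using False by (simp add: norm_mult norm_sgn del: of_real_add)
  moreover have "norm ?w = 1"
    using False by (simp add: norm_divide norm_sgn)
  ultimately show ?thesis using that by blast
qed

text \<open>
  Phrased with component functions rather than the tetrablock, so that it applies to the
  coordinates in either order.
\<close>
lemma deriv_sum_le_one_of_cross_less:
  assumes hol: "f1 holomorphic_on ball 0 1" "f2 holomorphic_on ball 0 1" "f3 holomorphic_on ball 0 1"
    and zero: "f1 0 = 0" "f2 0 = 0" "f3 0 = 0"
    and cross: "\<And>\<zeta> w. norm \<zeta> < 1 \<Longrightarrow> norm w \<le> 1 \<Longrightarrow>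
                  norm (f1 \<zeta> - f3 \<zeta> * w) < norm (1 - f2 \<zeta> * w)"
  shows "norm (deriv f1 0) + norm (deriv f3 0) \<le> 1"
proof -
  obtain w where w: "norm w = 1"
    and al: "norm (deriv f1 0 - deriv f3 0 * w) = norm (deriv f1 0) + norm (deriv f3 0)"
    using obtain_aligning_phase .
  define F where "F = (\<lambda>\<zeta>. (f1 \<zeta> - f3 \<zeta> * w) / (1 - f2 \<zeta> * w))"
  have less: "norm (f1 \<zeta> - f3 \<zeta> * w) < norm (1 - f2 \<zeta> * w)" if "norm \<zeta> < 1" for \<zeta>
    using cross[OF that] w by simp
  have nz: "1 - f2 \<zeta> * w \<noteq> 0" if "norm \<zeta> < 1" for \<zeta>
    using less[OF that] by auto
  have F_hol: "F holomorphic_on ball 0 1"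
    unfolding F_def using nz by (auto intro!: holomorphic_intros hol)
  have F_less: "norm (F \<zeta>) < 1" if "norm \<zeta> < 1" for \<zeta>
    using less[OF that] nz[OF that] by (simp add: F_def norm_divide)
  have "norm (deriv F 0) \<le> 1"
    using Schwarz_Lemma(2)[OF F_hol _ F_less, of 0] by (simp add: F_def zero)
  moreover have "deriv F 0 = deriv f1 0 - deriv f3 0 * w"
  proof -
    have d: "(f has_field_derivative deriv f 0) (at 0)"
      if "f holomorphic_on ball 0 1" for f :: "complex \<Rightarrow> complex"
      using that by (intro holomorphic_derivI[of _ "ball 0 1"]) auto
    note [derivative_intros] = d[OF hol(1)] d[OF hol(2)] d[OF hol(3)]
    have "(F has_field_derivative deriv f1 0 - deriv f3 0 * w) (at 0)"
      unfolding F_def by (auto intro!: derivative_eq_intros simp: zero)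
    thus ?thesis by (rule DERIV_imp_deriv)
  qed
  ultimately show ?thesis using al by simp
qed

section \<open>Sufficiency\<close>

text \<open>
  On the circle \<open>\<bar>\<nu>\<bar> = 1\<close> with \<open>a + \<bar>c\<bar> = 1\<close> the gap collapses to
  \<open>2 (1 - \<bar>Z\<bar>\<^sup>2) (\<bar>c\<bar> + Re (cnj c \<nu>))\<close>, which is visibly nonnegative. In general the deficits
  \<open>1 - \<bar>\<nu>\<bar>\<^sup>2\<close> and \<open>1 - \<bar>Z\<bar>\<^sup>2\<close> are split off as factors, leaving a last term that vanishes when
  \<open>a + \<bar>c\<bar> = 1\<close>.
\<close>
lemma quotient_gap_identity:
  fixes c \<nu> Z :: complex and a :: real
  shows "(norm (1 + cnj c * \<nu> - of_real a * Z))\<^sup>2 - (norm ((\<nu> + c) * Z - of_real a * \<nu>))\<^sup>2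
       = a * (1 - (norm \<nu>)\<^sup>2) * (norm (1 - Z))\<^sup>2
         + (1 - (norm Z)\<^sup>2) * ((1 - a) * (1 + (norm \<nu>)\<^sup>2) + 2 * Re (cnj c * \<nu>))
         + ((1 - a)\<^sup>2 - (norm c)\<^sup>2) * ((norm Z)\<^sup>2 - (norm \<nu>)\<^sup>2)"
  unfolding cmod_power2 by (simp add: power2_eq_square algebra_simps)

text \<open>
  The last term of the identity has no definite sign. It becomes harmless once
  \<open>1 - a = \<bar>c\<bar> + (1 - a - \<bar>c\<bar>)\<close> is substituted in the middle term: the part with \<open>\<bar>c\<bar>\<close> is
  nonnegative by \<open>Re (cnj c \<nu>) \<ge> - \<bar>c\<bar> \<bar>\<nu>\<bar>\<close>, and the rest shares the factor \<open>1 - a - \<bar>c\<bar>\<close> with the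
  last term.
\<close>
lemma quotient_gap_pos:
  fixes c \<nu> Z :: complex and a :: real
  assumes a: "0 \<le> a" and ac: "a + norm c \<le> 1" and \<nu>: "norm \<nu> < 1" and Z: "norm Z < 1"
  shows "norm ((\<nu> + c) * Z - of_real a * \<nu>) < norm (1 + cnj c * \<nu> - of_real a * Z)"
proof -
  define n m b s where "n = (norm \<nu>)\<^sup>2" and "m = (norm Z)\<^sup>2" and "b = norm c" and "s = 1 - a"
  have n: "0 \<le> n" "n < 1" and m: "0 \<le> m" "m < 1"
    using \<nu> Z by (auto simp: n_def m_def power_less_one_iff abs_square_less_1)
  have b: "0 \<le> b" "b \<le> s" "s \<le> 1" using a ac by (auto simp: b_def s_def)
  define T1 where "T1 = a * (1 - n) * (norm (1 - Z))\<^sup>2"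
  define T2 where "T2 = (1 - m) * (b * (1 + n) + 2 * Re (cnj c * \<nu>))"
  define U where "U = (1 - m) * (1 + n) + (s + b) * (m - n)"
  have T1: "T1 \<ge> 0" "a > 0 \<Longrightarrow> T1 > 0"
    using a n Z by (auto simp: T1_def intro!: mult_pos_pos)
  have T2_ge: "T2 \<ge> (1 - m) * (b * (1 - norm \<nu>)\<^sup>2)"
  proof -
    have "- Re (cnj c * \<nu>) \<le> b * norm \<nu>"
      using complex_Re_le_cmod[of "- (cnj c * \<nu>)"] by (simp add: norm_mult b_def)
    hence "b * (1 - norm \<nu>)\<^sup>2 \<le> b * (1 + n) + 2 * Re (cnj c * \<nu>)"
      by (simp add: n_def power2_eq_square algebra_simps)
    thus ?thesis unfolding T2_def using m by (intro mult_left_mono) auto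
  qed
  hence T2: "T2 \<ge> 0" "b > 0 \<Longrightarrow> T2 > 0"
    using m b \<nu> by (smt (verit) mult_nonneg_nonneg zero_le_power2,
                    smt (verit) mult_pos_pos zero_less_power)
  \<comment> \<open>\<open>U\<close> is affine in \<open>s + b\<close>, which lies between 0 and 2, and is positive at both ends.\<close>
  have "U = (1 - (s + b) / 2) * ((1 - m) * (1 + n)) + (s + b) / 2 * ((1 - n) * (1 + m))"
    by (simp add: U_def field_simps)
  moreover have "(1 - m) * (1 + n) > 0" "(1 - n) * (1 + m) > 0" using n m by auto
  moreover have "0 \<le> (s + b) / 2" "(s + b) / 2 \<le> 1" using b by auto
  ultimately have U: "U > 0"
    by (smt (verit) mult_nonneg_nonneg mult_pos_pos)
  have "T1 + T2 + (s - b) * U > 0"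
  proof -
    have "(s - b) * U \<ge> 0" "s > b \<Longrightarrow> (s - b) * U > 0" using b U by auto
    moreover have "a > 0 \<or> b > 0 \<or> s > b" using a b by (auto simp: s_def)
    ultimately show ?thesis using T1 T2 by linarith
  qed
  also have "T1 + T2 + (s - b) * U
      = (norm (1 + cnj c * \<nu> - of_real a * Z))\<^sup>2 - (norm ((\<nu> + c) * Z - of_real a * \<nu>))\<^sup>2"
    unfolding quotient_gap_identity T1_def T2_def U_def n_def[symmetric] m_def[symmetric]
      b_def[symmetric] s_def[symmetric]
    by (simp add: power2_eq_square algebra_simps)
  finally show ?thesis
    by (simp add: power2_less_imp_less)
qed

lemma quotient_in_tetrablock:
  fixes c \<nu> \<zeta> :: complex and a :: real
  assumes "0 \<le> a" "a + norm c \<le> 1" "norm \<nu> < 1" "norm \<zeta> < 1"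
  defines "d \<equiv> 1 + cnj c * \<nu>"
  shows "vector [of_real a * \<zeta> / d, of_real a * \<nu> / d, \<zeta> * (\<nu> + c) / d] \<in> tetrablock"
  unfolding vector_in_tetrablock_iff
proof (intro allI impI)
  fix z w :: complex
  assume z: "norm z \<le> 1" and w: "norm w \<le> 1"
  define Z where "Z = \<zeta> * z"
  have gap: "norm ((\<nu> + c) * \<xi> - of_real a * \<nu>) < norm (d - of_real a * \<xi>)" if "norm \<xi> < 1" for \<xi>
    using quotient_gap_pos[OF assms(1-3) that] by (simp add: d_def)
  have d: "d \<noteq> 0"
    using gap[of 0] by auto
  have "norm Z \<le> norm \<zeta>"
    using z by (simp add: Z_def norm_mult mult_left_le)
  hence "norm Z < 1" using assms(4) by simp
  hence "norm ((\<nu> + c) * Z - of_real a * \<nu>) < norm (d - of_real a * Z)"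
    by (rule gap)
  moreover have "norm (((\<nu> + c) * Z - of_real a * \<nu>) * w) \<le> norm ((\<nu> + c) * Z - of_real a * \<nu>)"
    using w by (simp add: norm_mult mult_left_le)
  ultimately have "norm (((\<nu> + c) * Z - of_real a * \<nu>) * w) < norm (d - of_real a * Z)"
    by simp
  hence "(d - of_real a * Z) + ((\<nu> + c) * Z - of_real a * \<nu>) * w \<noteq> 0"
    by (metis add_eq_0_iff less_irrefl norm_minus_cancel)
  moreover have "1 - of_real a * \<zeta> / d * z - of_real a * \<nu> / d * w + \<zeta> * (\<nu> + c) / d * z * w
      = ((d - of_real a * Z) + ((\<nu> + c) * Z - of_real a * \<nu>) * w) / d"
    using d by (simp add: Z_def field_simps)
  ultimately show "1 - of_real a * \<zeta> / d * z - of_real a * \<nu> / d * w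
      + \<zeta> * (\<nu> + c) / d * z * w \<noteq> 0"
    using d by simp
qed

text \<open>
  Dominance of \<open>y1\<close> is what makes \<open>m = y2 / \<bar>y1\<bar>\<close> a point of the closed disc, so that \<open>\<zeta> \<mapsto> m \<zeta>\<close> can
  serve as the parameter \<open>\<nu>\<close>. The phase \<open>k\<close> of \<open>y1\<close> goes into the other parameter, and \<open>c\<close>
  compensates for it in the third coordinate.
\<close>
lemma exists_disc_of_dominant_first:
  fixes y1 y2 y3 :: complex
  assumes dom: "norm y2 \<le> norm y1" and sum: "norm y1 + norm y3 \<le> 1"
  obtains f1 f2 f3 :: "complex \<Rightarrow> complex"
  where "f1 holomorphic_on ball 0 1" "f2 holomorphic_on ball 0 1" "f3 holomorphic_on ball 0 1"
    and "f1 0 = 0" "f2 0 = 0" "f3 0 = 0"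
    and "deriv f1 0 = y1" "deriv f2 0 = y2" "deriv f3 0 = y3"
    and "\<And>\<zeta>. norm \<zeta> < 1 \<Longrightarrow> vector [f1 \<zeta>, f2 \<zeta>, f3 \<zeta>] \<in> tetrablock"
proof -
  define a where "a = norm y1"
  define k where "k = (if y1 = 0 then 1 else sgn y1)"
  define m where "m = y2 / of_real a"
  define c where "c = y3 / k"
  have k: "norm k = 1" by (simp add: k_def norm_sgn)
  have y1: "of_real a * k = y1" by (simp add: a_def k_def sgn_eq)
  \<comment> \<open>If \<open>a = 0\<close> then \<open>y2 = 0\<close> as well, and the default \<open>m = 0\<close> is the right choice.\<close>
  have y2: "of_real a * m = y2" using dom by (auto simp: a_def m_def)
  have m: "norm m \<le> 1" using dom by (simp add: m_def a_def norm_divide divide_le_eq_1)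
  have y3: "k * c = y3" using k by (auto simp: c_def)
  have "norm c = norm y3" using k by (simp add: c_def norm_divide)
  hence ac: "0 \<le> a" "a + norm c \<le> 1" using sum by (simp_all add: a_def)
  define d where "d = (\<lambda>\<zeta>. 1 + cnj c * (m * \<zeta>))"
  define f1 f2 f3 where "f1 = (\<lambda>\<zeta>. of_real a * (k * \<zeta>) / d \<zeta>)"
    and "f2 = (\<lambda>\<zeta>. of_real a * (m * \<zeta>) / d \<zeta>)"
    and "f3 = (\<lambda>\<zeta>. (k * \<zeta>) * (m * \<zeta> + c) / d \<zeta>)"
  have m_less: "norm (m * \<zeta>) < 1" if "norm \<zeta> < 1" for \<zeta>
    using m that by (metis le_less_trans mult_left_le_one_le norm_ge_zero norm_mult)
  have d: "d \<zeta> \<noteq> 0" if "norm \<zeta> < 1" for \<zeta>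
    using quotient_gap_pos[OF ac m_less[OF that], of 0] by (auto simp: d_def)
  show ?thesis
  proof
    show "f1 holomorphic_on ball 0 1" "f2 holomorphic_on ball 0 1" "f3 holomorphic_on ball 0 1"
      using d unfolding f1_def f2_def f3_def d_def by (auto intro!: holomorphic_intros)
    show "f1 0 = 0" "f2 0 = 0" "f3 0 = 0" by (simp_all add: f1_def f2_def f3_def)
    show "deriv f1 0 = y1" "deriv f2 0 = y2" "deriv f3 0 = y3"
      unfolding f1_def f2_def f3_def d_def
      by (rule DERIV_imp_deriv, auto intro!: derivative_eq_intros simp: y1[symmetric] y2[symmetric] y3[symmetric])+
    show "vector [f1 \<zeta>, f2 \<zeta>, f3 \<zeta>] \<in> tetrablock" if "norm \<zeta> < 1" for \<zeta>
      using quotient_in_tetrablock[OF ac m_less[OF that], of "k * \<zeta>"] k that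
      by (simp add: f1_def f2_def f3_def d_def norm_mult)
  qed
qed

section \<open>The infinitesimal Schwarz lemma at the origin\<close>

theorem theorem2p1:
  fixes y :: "complex ^ 3"
  shows "(\<exists>\<phi> :: complex \<Rightarrow> complex ^ 3.
            \<phi> vec_holomorphic_on ball 0 1 \<and> \<phi> ` ball 0 1 \<subseteq> tetrablock \<and>
            \<phi> 0 = 0 \<and> vec_deriv \<phi> 0 = y)
         \<longleftrightarrow> max (norm (y $ 1)) (norm (y $ 2)) + norm (y $ 3) \<le> 1"
proof
  assume "\<exists>\<phi> :: complex \<Rightarrow> complex ^ 3.
            \<phi> vec_holomorphic_on ball 0 1 \<and> \<phi> ` ball 0 1 \<subseteq> tetrablock \<and>
            \<phi> 0 = 0 \<and> vec_deriv \<phi> 0 = y"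
  then obtain \<phi> :: "complex \<Rightarrow> complex ^ 3"
    where hol: "\<And>i :: 3. (\<lambda>\<zeta>. \<phi> \<zeta> $ i) holomorphic_on ball 0 1"
      and ran: "\<And>\<zeta>. norm \<zeta> < 1 \<Longrightarrow> \<phi> \<zeta> \<in> tetrablock"
      and zero: "\<phi> 0 = 0" and der: "vec_deriv \<phi> 0 = y"
    unfolding vec_holomorphic_on_def by fastforce
  have y: "deriv (\<lambda>\<zeta>. \<phi> \<zeta> $ i) 0 = y $ i" for i :: 3
    using der by (auto simp: vec_deriv_def)
  have "norm (y $ 1) + norm (y $ 3) \<le> 1"
    using deriv_sum_le_one_of_cross_less[OF hol[of 1] hol[of 2] hol[of 3]]
      tetrablock_cross_less[OF ran] by (simp add: zero y)
  moreover have "norm (\<phi> \<zeta> $ 2 - \<phi> \<zeta> $ 3 * w) < norm (1 - \<phi> \<zeta> $ 1 * w)"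
    if "norm \<zeta> < 1" "norm w \<le> 1" for \<zeta> w
  proof -
    have "vector [\<phi> \<zeta> $ 1, \<phi> \<zeta> $ 2, \<phi> \<zeta> $ 3] = \<phi> \<zeta>"
      by (simp add: vec_eq_iff forall_3)
    hence "vector [\<phi> \<zeta> $ 2, \<phi> \<zeta> $ 1, \<phi> \<zeta> $ 3] \<in> tetrablock"
      using ran[OF that(1)] tetrablock_swap[of "\<phi> \<zeta> $ 1" "\<phi> \<zeta> $ 2" "\<phi> \<zeta> $ 3"] by simp
    from tetrablock_cross_less[OF this that(2)] show ?thesis by simp
  qed
  hence "norm (y $ 2) + norm (y $ 3) \<le> 1"
    using deriv_sum_le_one_of_cross_less[OF hol[of 2] hol[of 1] hol[of 3]]
    by (simp add: zero y)
  ultimately show "max (norm (y $ 1)) (norm (y $ 2)) + norm (y $ 3) \<le> 1" by simp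
next
  assume le: "max (norm (y $ 1)) (norm (y $ 2)) + norm (y $ 3) \<le> 1"
  have "\<exists>f1 f2 f3. f1 holomorphic_on ball 0 1 \<and> f2 holomorphic_on ball 0 1 \<and>
          f3 holomorphic_on ball 0 1 \<and> f1 0 = 0 \<and> f2 0 = 0 \<and> f3 0 = 0 \<and>
          deriv f1 0 = y $ 1 \<and> deriv f2 0 = y $ 2 \<and> deriv f3 0 = y $ 3 \<and>
          (\<forall>\<zeta>. norm \<zeta> < 1 \<longrightarrow> vector [f1 \<zeta>, f2 \<zeta>, f3 \<zeta>] \<in> tetrablock)"
  proof (cases "norm (y $ 2) \<le> norm (y $ 1)")
    case True
    show ?thesis
      by (rule exists_disc_of_dominant_first[OF True, of "y $ 3"]) (use le True in auto)
  next
    case False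
    hence *: "norm (y $ 1) \<le> norm (y $ 2)" by simp
    show ?thesis
      by (rule exists_disc_of_dominant_first[OF *, of "y $ 3"])
        (use le in simp, use tetrablock_swap in blast)
  qed
  then obtain f1 f2 f3 where f: "f1 holomorphic_on ball 0 1" "f2 holomorphic_on ball 0 1"
      "f3 holomorphic_on ball 0 1" "f1 0 = 0" "f2 0 = 0" "f3 0 = 0"
      "deriv f1 0 = y $ 1" "deriv f2 0 = y $ 2" "deriv f3 0 = y $ 3"
      and ran: "\<And>\<zeta>. norm \<zeta> < 1 \<Longrightarrow> vector [f1 \<zeta>, f2 \<zeta>, f3 \<zeta>] \<in> tetrablock"
    by blast
  define \<phi> :: "complex \<Rightarrow> complex ^ 3" where "\<phi> = (\<lambda>\<zeta>. vector [f1 \<zeta>, f2 \<zeta>, f3 \<zeta>])"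
  have "\<phi> vec_holomorphic_on ball 0 1"
    using f by (simp add: vec_holomorphic_on_def \<phi>_def forall_3)
  moreover have "\<phi> ` ball 0 1 \<subseteq> tetrablock" using ran by (auto simp: \<phi>_def)
  moreover have "\<phi> 0 = 0" using f by (simp add: \<phi>_def vec_eq_iff forall_3)
  moreover have "vec_deriv \<phi> 0 = y"
    using f by (simp add: vec_deriv_def \<phi>_def vec_eq_iff forall_3)
  ultimately show "\<exists>\<phi> :: complex \<Rightarrow> complex ^ 3.
            \<phi> vec_holomorphic_on ball 0 1 \<and> \<phi> ` ball 0 1 \<subseteq> tetrablock \<and>
            \<phi> 0 = 0 \<and> vec_deriv \<phi> 0 = y" by blast
qed

end
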